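(* $\ell(k) = \Theta(k^2)$ as $k \to \infty$; that is, there exist constants $c, C > 0$ and an integer $k_0 \geq 1$ such that $c k^2 \leq \ell(k) \leq C k^2$ for all integers $k \geq k_0$.
   Context: A finite word is an abelian square of order $r$ if it is of the form $xx'$ with $|x| = |x'| = r$ and $x'$ a permutation (rearrangement of the letters) of $x$. A word contains an abelian square if some contiguous block (factor) of it is an abelian square. For an integer $k \geq 1$, $\ell(k)$ denotes the length of the longest word over $\{0,1\}$ containing no abelian square of order $\geq k$. (It is a known theorem of Entringer, Jackson and Schatz that every binary word of length $k^2+6k$ contains an abelian square of order $k$ or greater, so $\ell(k)$ is a well-defined finite number.) *)

theory Defs
  imports Complex_Main "HOL-Library.Multiset" "HOL-Library.Sublist"
begin

definition abelian_square :: "nat \<Rightarrow> 'a list \<Rightarrow> bool" where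
  "abelian_square r w \<longleftrightarrow>
     (\<exists>x x'. w = x @ x' \<and> length x = r \<and> length x' = r \<and> mset x' = mset x)"

text \<open>The predicate \<^const>\<open>sublist\<close> of the library means contiguous sublist, that is, factor.\<close>

definition avoids_abelian_squares_from :: "nat \<Rightarrow> 'a list \<Rightarrow> bool" where
  "avoids_abelian_squares_from k w \<longleftrightarrow>
     (\<forall>u r. sublist u w \<longrightarrow> k \<le> r \<longrightarrow> \<not> abelian_square r u)"

text \<open>The set of lengths below is finite for \<open>k \<ge> 1\<close> by the theorem of Entringer, Jackson and
  Schatz, and it contains 0, so that the maximum is attained. For \<open>k = 0\<close> the set is empty
  (the empty word is an abelian square of order 0) and the value of \<open>ell\<close> is irrelevant.\<close>

definition ell :: "nat \<Rightarrow> nat" where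
  "ell k = Max {length w | w :: nat list. set w \<subseteq> {0, 1} \<and> avoids_abelian_squares_from k w}"

end

theory Submission
  imports Defs
begin

text \<open>Let \<open>s i\<close> be the number of ones among the first \<open>i\<close> letters of a binary word. Two
  adjacent blocks of length \<open>r\<close> that meet at position \<open>m\<close> form an abelian square exactly when the
  symmetric second difference \<open>D m r = s (m + r) + s (m - r) - 2 * s m\<close> vanishes
  (\<open>avoids_iff_sdiff_nonzero\<close>), so the question is for how long \<open>D m r\<close> can be kept away from \<open>0\<close>
  for all \<open>r \<ge> k\<close>.

  Lower bound: \<open>D\<close> is positive if \<open>s\<close> is sufficiently convex. The choice
  \<open>s i = \<lfloor>i\<^sup>2 / k\<^sup>2\<rfloor>\<close> has unrounded second difference \<open>2 r\<^sup>2 / k\<^sup>2 \<ge> 2\<close>, and rounding loses less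
  than \<open>2\<close>. The slope of \<open>i\<^sup>2 / k\<^sup>2\<close> stays at most \<open>1\<close> up to \<open>i\<close> about \<open>k\<^sup>2 / 2\<close>, so that \<open>s\<close>
  counts the ones of a binary word of that length (\<open>sdiff_quadratic_pos\<close>, \<open>long_avoiding_word\<close>).

  Upper bound (Entringer, Jackson and Schatz): for fixed \<open>m\<close>, incrementing \<open>r\<close> changes \<open>D m r\<close>
  by at most \<open>1\<close>, so a nonvanishing \<open>D m r\<close> has a sign that depends on \<open>m\<close> alone. A change of
  sign between \<open>m\<close> and \<open>m + 1\<close> forces the change of \<open>D\<close> to be extremal for every \<open>r\<close> at once,
  hence a long run of equal letters, which contains an abelian square (\<open>sgn_sdiff_Suc\<close>). So the
  sign is constant away from the ends of the word, and the numbers of ones in consecutive blocks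
  of length \<open>k\<close> are strictly monotone. They lie in \<open>{0..k}\<close>, so there are at most \<open>k + 1\<close> such
  blocks (\<open>sdiff_nonzero_imp_short\<close>).\<close>

section \<open>Abelian squares as zeros of a second difference\<close>

definition sdiff :: "(nat \<Rightarrow> int) \<Rightarrow> nat \<Rightarrow> nat \<Rightarrow> int" where
  "sdiff s m r = s (m + r) + s (m - r) - 2 * s m"

definition ones :: "nat list \<Rightarrow> nat \<Rightarrow> int" where
  "ones w i = int (sum_list (take i w))"

lemma mset_binary:
  fixes x :: "nat list"
  assumes "set x \<subseteq> {0, 1}"
  shows "sum_list x \<le> length x \<and>
    mset x = replicate_mset (sum_list x) 1 + replicate_mset (length x - sum_list x) 0"
  using assms by (induction x) (auto simp: Suc_diff_le)

lemma mset_binary_eq_iff: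
  fixes x y :: "nat list"
  assumes "set x \<subseteq> {0, 1}" "set y \<subseteq> {0, 1}" "length x = length y"
  shows "mset x = mset y \<longleftrightarrow> sum_list x = sum_list y"
  using mset_binary[OF assms(1)] mset_binary[OF assms(2)] assms(3)
  by (metis sum_mset_sum_list)

lemma avoids_iff_sdiff_nonzero:
  fixes w :: "nat list"
  assumes bin: "set w \<subseteq> {0, 1}"
  shows "avoids_abelian_squares_from k w \<longleftrightarrow>
    (\<forall>m r. k \<le> r \<longrightarrow> r \<le> m \<longrightarrow> m + r \<le> length w \<longrightarrow> sdiff (ones w) m r \<noteq> 0)"
    (is "_ \<longleftrightarrow> ?R")
proof
  assume av: "avoids_abelian_squares_from k w"
  show ?R
  proof (intro allI impI notI)
    fix m r
    assume r: "k \<le> r" "r \<le> m" "m + r \<le> length w" and z: "sdiff (ones w) m r = 0"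
    define p where "p = take (m - r) w"
    define x where "x = take r (drop (m - r) w)"
    define y where "y = take r (drop m w)"
    have t1: "take m w = p @ x"
      using r take_add[of "m - r" r w] by (simp add: p_def x_def)
    have t2: "take (m + r) w = p @ x @ y"
      using take_add[of m r w] t1 by (simp add: y_def)
    have len: "length x = r" "length y = r" using r by (auto simp: x_def y_def)
    have "sum_list y = sum_list x"
      using z t1 t2 by (simp add: sdiff_def ones_def p_def[symmetric])
    moreover have "set x \<subseteq> {0, 1}" "set y \<subseteq> {0, 1}"
      using bin by (auto simp: x_def y_def dest!: in_set_takeD in_set_dropD)
    ultimately have "mset y = mset x" using mset_binary_eq_iff len by metis
    then have sq: "abelian_square r (x @ y)" using len by (auto simp: abelian_square_def)
    have "w = p @ (x @ y) @ drop (m + r) w"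
      using t2 append_take_drop_id[of "m + r" w] by simp
    then have "sublist (x @ y) w" unfolding sublist_def by blast
    then show False using av sq r by (auto simp: avoids_abelian_squares_from_def)
  qed
next
  assume R: ?R
  show "avoids_abelian_squares_from k w"
    unfolding avoids_abelian_squares_from_def
  proof (intro allI impI notI)
    fix u r
    assume "sublist u w" and r: "k \<le> r" and "abelian_square r u"
    then obtain p x y q where w: "w = p @ x @ y @ q" and len: "length x = r" "length y = r"
      and ms: "mset y = mset x"
      by (auto simp: sublist_def abelian_square_def)
    have "sum_list y = sum_list x" using ms by (metis sum_mset_sum_list)
    then have "sdiff (ones w) (length p + r) r = 0"
      using len by (simp add: sdiff_def ones_def w)
    moreover have "length p + r + r \<le> length w" using len by (simp add: w)
    ultimately show False using R r by simp
  qed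
qed

lemma ones_Suc:
  assumes "set w \<subseteq> {0, 1}" "i < length w"
  shows "ones w (Suc i) - ones w i \<in> {0, 1}"
proof -
  have "w ! i \<in> {0, 1}" using assms nth_mem by blast
  then show ?thesis using assms by (auto simp: ones_def take_Suc_conv_app_nth)
qed

section \<open>Upper bound: the second difference has constant sign\<close>

text \<open>Continuity in the radius: the center being fixed, incrementing \<open>r\<close> adds one letter on the
  right and subtracts one on the left, so that the second difference cannot jump over \<open>0\<close>.\<close>

lemma sgn_sdiff_radius:
  fixes s :: "nat \<Rightarrow> int"
  assumes step: "\<And>i. i < n \<Longrightarrow> s (Suc i) - s i \<in> {0, 1}"
    and nz: "\<And>r. k \<le> r \<Longrightarrow> r \<le> m \<Longrightarrow> m + r \<le> n \<Longrightarrow> sdiff s m r \<noteq> 0"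
    and "k \<le> r" "r \<le> m" "m + r \<le> n"
  shows "sgn (sdiff s m r) = sgn (sdiff s m k)"
  using assms(3-5)
proof (induction r rule: dec_induct)
  case base
  show ?case by simp
next
  case (step r)
  have "s (Suc (m + r)) - s (m + r) \<in> {0, 1}" using assms(1) step.prems by simp
  moreover have "s (m - r) - s (m - Suc r) \<in> {0, 1}"
    using assms(1)[of "m - Suc r"] step.prems by (simp add: Suc_diff_Suc)
  ultimately have "\<bar>sdiff s m (Suc r) - sdiff s m r\<bar> \<le> 1"
    by (auto simp: sdiff_def)
  moreover have "sdiff s m (Suc r) \<noteq> 0" "sdiff s m r \<noteq> 0"
    using nz step by auto
  ultimately have "sgn (sdiff s m (Suc r)) = sgn (sdiff s m r)"
    by (auto simp: sgn_if)
  then show ?case using step by simp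
qed

lemma sum_of_constant_steps:
  fixes s :: "nat \<Rightarrow> int"
  assumes "\<And>i. i < l \<Longrightarrow> s (Suc (a + i)) - s (a + i) = d"
  shows "s (a + l) = s a + int l * d"
  using assms
proof (induction l)
  case (Suc l)
  have "s (Suc (a + l)) = s (a + l) + d" using Suc.prems[of l] by simp
  moreover have "s (a + l) = s a + int l * d" using Suc by simp
  ultimately show ?case by (simp add: algebra_simps)
qed simp

text \<open>Moving the center by one changes the second difference by at most \<open>2\<close>. If the sign
  flips, the change is exactly \<open>2\<close> for every radius, which determines the letter at distance \<open>r\<close>
  from the center: all these letters are equal, and \<open>2 * k\<close> equal letters are an abelian
  square of order \<open>k\<close>.\<close>

lemma sgn_sdiff_Suc:
  fixes s :: "nat \<Rightarrow> int"
  assumes step: "\<And>i. i < n \<Longrightarrow> s (Suc i) - s i \<in> {0, 1}"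
    and nz: "\<And>m r. k \<le> r \<Longrightarrow> r \<le> m \<Longrightarrow> m + r \<le> n \<Longrightarrow> sdiff s m r \<noteq> 0"
    and m: "3 * k \<le> m" "Suc m + 3 * k \<le> n"
  shows "sgn (sdiff s (Suc m) k) = sgn (sdiff s m k)"
proof (rule ccontr)
  assume flip: "sgn (sdiff s (Suc m) k) \<noteq> sgn (sdiff s m k)"
  have nz1: "sdiff s m k \<noteq> 0" and nz2: "sdiff s (Suc m) k \<noteq> 0"
    using nz m by auto
  define d :: int where "d = (if sdiff s m k > 0 then 0 else 1)"
  have far: "s (Suc (m + r)) - s (m + r) = d" if r: "k \<le> r" "r \<le> 3 * k" for r
  proof -
    have sg1: "sgn (sdiff s m r) = sgn (sdiff s m k)"
      by (rule sgn_sdiff_radius[OF step nz]) (use r m in auto)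
    have sg2: "sgn (sdiff s (Suc m) r) = sgn (sdiff s (Suc m) k)"
      by (rule sgn_sdiff_radius[OF step nz]) (use r m in auto)
    have s1: "s (Suc (m + r)) - s (m + r) \<in> {0, 1}"
      and s2: "s (Suc (m - r)) - s (m - r) \<in> {0, 1}"
      and s3: "s (Suc m) - s m \<in> {0, 1}"
      using r m by (auto intro!: step simp del: insert_iff)
    have eq: "sdiff s (Suc m) r - sdiff s m r = (s (Suc (m + r)) - s (m + r))
        + (s (Suc (m - r)) - s (m - r)) - 2 * (s (Suc m) - s m)"
      using r m by (simp add: sdiff_def Suc_diff_le)
    show ?thesis
    proof (cases "sdiff s m k > 0")
      case True
      then have "sdiff s m r \<ge> 1" "sdiff s (Suc m) r \<le> -1"
        using sg1 sg2 flip nz1 nz2 by (auto simp: sgn_if split: if_splits)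
      then show ?thesis using True eq s1 s2 s3 by (auto simp: d_def)
    next
      case False
      then have "sdiff s m r \<le> -1" "sdiff s (Suc m) r \<ge> 1"
        using sg1 sg2 flip nz1 nz2 by (auto simp: sgn_if split: if_splits)
      then show ?thesis using False eq s1 s2 s3 by (auto simp: d_def)
    qed
  qed
  have "s (m + k + k) = s (m + k) + int k * d"
    by (rule sum_of_constant_steps) (use far[of "k + _"] in \<open>simp add: add.assoc\<close>)
  moreover have "s (m + 2 * k + k) = s (m + 2 * k) + int k * d"
    by (rule sum_of_constant_steps) (use far[of "2 * k + _"] in \<open>simp add: add.assoc\<close>)
  moreover have mid: "m + k + k = m + 2 * k" "m + 2 * k - k = m + k" by simp_all
  ultimately have "sdiff s (m + 2 * k) k = 0"
    unfolding sdiff_def mid by linarith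
  then show False using nz[of k "m + 2 * k"] m by simp
qed

lemma sgn_sdiff_constant:
  fixes s :: "nat \<Rightarrow> int"
  assumes step: "\<And>i. i < n \<Longrightarrow> s (Suc i) - s i \<in> {0, 1}"
    and nz: "\<And>m r. k \<le> r \<Longrightarrow> r \<le> m \<Longrightarrow> m + r \<le> n \<Longrightarrow> sdiff s m r \<noteq> 0"
    and "3 * k \<le> m" "m + 3 * k \<le> n"
  shows "sgn (sdiff s m k) = sgn (sdiff s (3 * k) k)"
  using assms(3,4)
proof (induction m rule: dec_induct)
  case (step m)
  have "sgn (sdiff s (Suc m) k) = sgn (sdiff s m k)"
    by (rule sgn_sdiff_Suc[OF assms(1,2)]) (use step in auto)
  then show ?case using step by simp
qed simp

text \<open>A positive second difference makes the numbers of ones in consecutive blocks of length \<open>k\<close>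
  strictly increasing, so that \<open>k + 2\<close> blocks would need a value above \<open>k\<close>.\<close>

lemma not_sdiff_all_pos:
  fixes s :: "nat \<Rightarrow> int"
  assumes step: "\<And>i. i < a + (k + 2) * k \<Longrightarrow> s (Suc i) - s i \<in> {0, 1}"
    and pos: "\<And>m. a + k \<le> m \<Longrightarrow> m + k \<le> a + (k + 2) * k \<Longrightarrow> sdiff s m k > 0"
  shows False
proof -
  have grow: "0 \<le> s (i + l) - s i \<and> s (i + l) - s i \<le> int l" if "i + l \<le> a + (k + 2) * k" for i l
    using that
  proof (induction l)
    case (Suc l)
    then show ?case using step[of "i + l"] by auto
  qed simp
  have incr: "int j \<le> s (a + j * k + k) - s (a + j * k)" if "j \<le> k + 1" for j
    using that
  proof (induction j)
    case 0
    show ?case using grow[of a k] by simp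
  next
    case (Suc j)
    have "j * k \<le> k * k" using Suc.prems by simp
    then have "sdiff s (a + j * k + k) k > 0" by (intro pos) (auto simp: algebra_simps)
    then show ?case using Suc by (simp add: sdiff_def ac_simps)
  qed
  have "s (a + (k + 1) * k + k) - s (a + (k + 1) * k) \<le> int k"
    using grow[of "a + (k + 1) * k" k] by (simp add: algebra_simps)
  then show False using incr[of "k + 1"] by simp
qed

lemma sdiff_nonzero_imp_short:
  fixes s :: "nat \<Rightarrow> int"
  assumes step: "\<And>i. i < n \<Longrightarrow> s (Suc i) - s i \<in> {0, 1}"
    and nz: "\<And>m r. k \<le> r \<Longrightarrow> r \<le> m \<Longrightarrow> m + r \<le> n \<Longrightarrow> sdiff s m r \<noteq> 0"
  shows "n < k ^ 2 + 6 * k"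
proof (rule ccontr)
  assume "\<not> n < k ^ 2 + 6 * k"
  then have n: "2 * k + (k + 2) * k + 2 * k \<le> n" by (simp add: power2_eq_square algebra_simps)
  have sg: "sgn (sdiff s m k) = sgn (sdiff s (3 * k) k)"
    if "2 * k + k \<le> m" "m + k \<le> 2 * k + (k + 2) * k" for m
    by (rule sgn_sdiff_constant[OF step nz]) (use that n in auto)
  show False
  proof (cases "sdiff s (3 * k) k > 0")
    case True
    show False
    proof (rule not_sdiff_all_pos[of "2 * k" k s])
      show "s (Suc i) - s i \<in> {0, 1}" if "i < 2 * k + (k + 2) * k" for i
        using step that n by simp
      show "sdiff s m k > 0" if "2 * k + k \<le> m" "m + k \<le> 2 * k + (k + 2) * k" for m
        using sg[OF that] True by (simp add: sgn_if split: if_splits)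
    qed
  next
    case False
    have neg: "sdiff s (3 * k) k < 0" using False nz[of k "3 * k"] n by simp
    \<comment> \<open>Exchange the two letters: counting zeros reverses the sign.\<close>
    define t where "t = (\<lambda>i. int i - s i)"
    show False
    proof (rule not_sdiff_all_pos[of "2 * k" k t])
      show "t (Suc i) - t i \<in> {0, 1}" if "i < 2 * k + (k + 2) * k" for i
        using step[of i] that n by (auto simp: t_def)
      show "sdiff t m k > 0" if "2 * k + k \<le> m" "m + k \<le> 2 * k + (k + 2) * k" for m
      proof -
        have "sdiff s m k < 0" using sg[OF that] neg by (simp add: sgn_if split: if_splits)
        then show ?thesis using that by (simp add: t_def sdiff_def)
      qed
    qed
  qed
qed

section \<open>Lower bound: a quadratic number of ones\<close>

lemma sdiff_quadratic_pos:
  assumes "1 \<le> k" "k \<le> r" "r \<le> m"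
  shows "sdiff (\<lambda>i. int (i\<^sup>2 div k\<^sup>2)) m r > 0"
proof -
  define K where "K = int (k\<^sup>2)"
  define f where "f = (\<lambda>i. int (i\<^sup>2 div k\<^sup>2))"
  have K: "K > 0" using assms by (simp add: K_def)
  have lo: "K * f i \<le> (int i)\<^sup>2" and hi: "(int i)\<^sup>2 < K * f i + K" for i
  proof -
    have "(int i)\<^sup>2 = K * f i + int (i\<^sup>2 mod k\<^sup>2)"
      unfolding K_def f_def of_nat_mult[symmetric] of_nat_add[symmetric] of_nat_power[symmetric]
      by simp
    moreover have "int (i\<^sup>2 mod k\<^sup>2) < K" using assms by (simp add: K_def)
    ultimately show "K * f i \<le> (int i)\<^sup>2" "(int i)\<^sup>2 < K * f i + K" by auto
  qed
  have "(int (m + r))\<^sup>2 + (int (m - r))\<^sup>2 - 2 * (int m)\<^sup>2 = 2 * (int r)\<^sup>2"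
    using assms by (simp add: power2_eq_square algebra_simps)
  moreover have "K \<le> (int r)\<^sup>2" using assms by (simp add: K_def power_mono)
  ultimately have "K * (f (m + r) + f (m - r) - 2 * f m) > 0"
    using hi[of "m + r"] hi[of "m - r"] lo[of m] by (simp add: algebra_simps)
  then show ?thesis using K by (simp add: sdiff_def f_def zero_less_mult_iff)
qed

lemma long_avoiding_word:
  assumes "1 \<le> k"
  obtains w :: "nat list"
  where "length w = k\<^sup>2 div 2" "set w \<subseteq> {0, 1}" "avoids_abelian_squares_from k w"
proof -
  define f where "f = (\<lambda>i. i\<^sup>2 div k\<^sup>2)"
  define w where "w = map (\<lambda>i. f (Suc i) - f i) [0..<k\<^sup>2 div 2]"
  have mono: "f i \<le> f (Suc i)" for i
    by (auto simp: f_def intro!: div_le_mono power_mono)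
  have le: "f (Suc i) \<le> f i + 1" if "i < k\<^sup>2 div 2" for i
  proof -
    have "(Suc i)\<^sup>2 \<le> i\<^sup>2 + k\<^sup>2" using that by (simp add: power2_eq_square)
    then have "f (Suc i) \<le> (i\<^sup>2 + k\<^sup>2) div k\<^sup>2" unfolding f_def by (rule div_le_mono)
    then show ?thesis using assms by (simp add: f_def)
  qed
  have bin: "set w \<subseteq> {0, 1}"
  proof
    fix x assume "x \<in> set w"
    then obtain i where "i < k\<^sup>2 div 2" "x = f (Suc i) - f i" by (auto simp: w_def)
    then show "x \<in> {0, 1}" using le[of i] by auto
  qed
  have ones: "ones w i = int (f i)" if "i \<le> k\<^sup>2 div 2" for i
    using that
  proof (induction i)
    case 0
    show ?case by (simp add: ones_def f_def)
  next
    case (Suc i)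
    then show ?case using mono[of i]
      by (simp add: ones_def w_def take_Suc_conv_app_nth)
  qed
  have "sdiff (ones w) m r \<noteq> 0" if "k \<le> r" "r \<le> m" "m + r \<le> length w" for m r
    using sdiff_quadratic_pos[OF assms that(1,2)] that(3) ones[of "m + r"] ones[of "m - r"] ones[of m]
    by (simp add: sdiff_def f_def w_def)
  then have "avoids_abelian_squares_from k w" using avoids_iff_sdiff_nonzero[OF bin] by blast
  then show ?thesis using that[of w] bin by (simp add: w_def)
qed

theorem mainTheorem3:
  "\<exists>c C :: real. \<exists>k0 :: nat. c > 0 \<and> C > 0 \<and> k0 \<ge> 1 \<and>
     (\<forall>k \<ge> k0. c * real k ^ 2 \<le> real (ell k) \<and> real (ell k) \<le> C * real k ^ 2)"
proof (rule exI[of _ "1/4"], rule exI[of _ 7], rule exI[of _ 2], intro conjI allI impI)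
  fix k :: nat
  assume k: "2 \<le> k"
  define L where
    "L = {length w | w :: nat list. set w \<subseteq> {0, 1} \<and> avoids_abelian_squares_from k w}"
  have bound: "l < k\<^sup>2 + 6 * k" if "l \<in> L" for l
  proof -
    obtain w :: "nat list" where w: "l = length w" "set w \<subseteq> {0, 1}"
      "avoids_abelian_squares_from k w" using \<open>l \<in> L\<close> by (auto simp: L_def)
    show ?thesis unfolding w(1)
      using sdiff_nonzero_imp_short[of "length w" "ones w" k]
        ones_Suc[OF w(2)] avoids_iff_sdiff_nonzero[OF w(2)] w(3) by blast
  qed
  then have fin: "finite L" by (meson bounded_nat_set_is_finite)
  have mem: "k\<^sup>2 div 2 \<in> L"
  proof -
    have "1 \<le> k" using k by simp
    then obtain w :: "nat list" where "length w = k\<^sup>2 div 2" "set w \<subseteq> {0, 1}"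
      "avoids_abelian_squares_from k w" by (rule long_avoiding_word)
    then show ?thesis unfolding L_def mem_Collect_eq by metis
  qed
  have ell: "ell k = Max L" by (simp add: ell_def L_def)
  have sq: "2 * k \<le> k\<^sup>2" using k by (simp add: power2_eq_square)
  have "k\<^sup>2 div 2 \<le> ell k" using fin mem by (simp add: ell)
  then have "k\<^sup>2 \<le> 4 * ell k" using sq k by linarith
  then have "real (k\<^sup>2) \<le> real (4 * ell k)" by (rule of_nat_mono)
  then show "1/4 * real k ^ 2 \<le> real (ell k)" by simp
  have "ell k \<in> L" unfolding ell using fin mem by (intro Max_in) auto
  then have "ell k < k\<^sup>2 + 6 * k" by (rule bound)
  then have "ell k \<le> 7 * k\<^sup>2" using sq by linarith
  then have "real (ell k) \<le> real (7 * k\<^sup>2)" by (rule of_nat_mono)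
  then show "real (ell k) \<le> 7 * real k ^ 2" by simp
qed auto

end
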